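(* Let $p$ be a prime and $L\ge 0$ an integer. Every $p$-ary sequence of period $p^L$ can be written as an $\mathbb{F}_p$-linear combination of binomial sequences modulo $p$ each of which has period $p^{\ell}$ for some $\ell\le L$.
   Context: A $p$-ary sequence is a sequence $\{s_n\}_{n\ge 0}$ with all terms in $\mathbb{F}_p$; addition and scalar multiplication of sequences are termwise. The period of a periodic sequence is the least positive integer $T$ with $s_{n+T}=s_n$ for all $n\ge 0$. For an integer $k\ge 0$, the $k$-th ($p$-ary) binomial sequence $\left\{\binom{n}{k}\right\}_{n\ge0}$ has $n$-th term $\binom{n}{k}\bmod p$, with $\binom{n}{k}=0$ for $n<k$. *)

theory Defs
  imports "HOL-Number_Theory.Residues"
begin

definition p_ary_seq :: "nat \<Rightarrow> (nat \<Rightarrow> int) \<Rightarrow> bool" where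
  "p_ary_seq p s \<longleftrightarrow> (\<forall>n. s n \<in> carrier (residue_ring (int p)))"

definition has_period :: "(nat \<Rightarrow> 'a) \<Rightarrow> nat \<Rightarrow> bool" where
  "has_period s T \<longleftrightarrow>
     0 < T \<and> (\<forall>n. s (n + T) = s n) \<and>
     (\<forall>T'. 0 < T' \<and> (\<forall>n. s (n + T') = s n) \<longrightarrow> T \<le> T')"

(* choose is 0 for n < k, so the terms before the k-th vanish. *)
definition binomial_seq :: "nat \<Rightarrow> nat \<Rightarrow> nat \<Rightarrow> int" where
  "binomial_seq p k n = int (n choose k) mod int p"

end

theory Submission imports Defs begin

text \<open>
  Newton interpolation writes \<open>s n\<close>, for \<open>n < p^L\<close>, as an integer combination of the
  binomial coefficients \<open>n choose k\<close> with \<open>k < p^L\<close>. By Vandermonde's identity and the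
  divisibility of \<open>p^L choose j\<close> by \<open>p\<close> for \<open>0 < j < p^L\<close>, these binomial sequences are
  \<open>p^L\<close>-periodic modulo \<open>p\<close>, so the combination equals \<open>s\<close> everywhere. Their least
  periods divide \<open>p^L\<close> and hence are powers of \<open>p\<close>.
\<close>

text \<open>Each addition in the residue ring is integer addition followed by reduction, so all
  reductions can be postponed to a single one at the end. This carries the ring sum of the theorem
  over to integer arithmetic.\<close>

lemma (in residues) finsum_eq_sum_mod:
  assumes "finite A" and "\<And>x. x \<in> A \<Longrightarrow> f x \<in> carrier R"
  shows "finsum R f A = (\<Sum>x\<in>A. f x) mod m"
  using assms
proof (induction A rule: finite_induct)
  case empty
  then show ?case by (simp add: zero_cong)
next
  case (insert x A)
  then have "finsum R f (insert x A) = f x \<oplus> finsum R f A"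
    by (intro finsum_insert) auto
  with insert show ?case
    by (simp add: res_add_eq mod_add_right_eq)
qed

text \<open>By absorption, \<open>p ^ l\<close> divides \<open>j * (p ^ l choose j)\<close>. If
  \<open>p\<close> did not divide the second factor, all of \<open>p ^ l\<close> would have to
  divide \<open>j\<close>, which is positive and too small.\<close>

lemma prime_dvd_prime_power_choose:
  fixes p :: nat
  assumes "prime p" and "0 < j" and "j < p ^ l"
  shows "p dvd p ^ l choose j"
proof (rule ccontr)
  assume "\<not> p dvd p ^ l choose j"
  then have "coprime (p ^ l) (p ^ l choose j)"
    using assms(1) by (simp add: prime_imp_coprime)
  moreover have "j * (p ^ l choose j) = p ^ l * (p ^ l - 1 choose (j - 1))"
    using assms(2) by (intro times_binomial_minus1_eq)
  then have "p ^ l dvd j * (p ^ l choose j)"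
    by simp
  ultimately have "p ^ l dvd j"
    by (simp add: coprime_dvd_mult_left_iff)
  with assms(2,3) show False
    by (auto dest: dvd_imp_le)
qed

lemma binomial_seq_add_prime_power:
  assumes "prime p" and "k < p ^ l"
  shows "binomial_seq p k (n + p ^ l) = binomial_seq p k n"
proof -
  have "p ^ l + n choose k = (\<Sum>j\<le>k. (p ^ l choose j) * (n choose (k - j)))"
    by (rule vandermonde [symmetric])
  also have "\<dots> = (n choose k) + (\<Sum>j\<in>{..k} - {0}. (p ^ l choose j) * (n choose (k - j)))"
    by (subst sum.remove [of _ 0]) auto
  finally have *: "n + p ^ l choose k =
      (n choose k) + (\<Sum>j\<in>{..k} - {0}. (p ^ l choose j) * (n choose (k - j)))"
    by (simp add: add.commute)
  \<comment> \<open>The bound \<open>k < p ^ l\<close> keeps every remaining index \<open>j\<close>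
    strictly between 0 and \<open>p ^ l\<close>, so only the split-off term \<open>j = 0\<close>
    survives modulo \<open>p\<close>.\<close>
  have "p dvd (\<Sum>j\<in>{..k} - {0}. (p ^ l choose j) * (n choose (k - j)))"
    using assms by (intro dvd_sum dvd_mult2 prime_dvd_prime_power_choose) auto
  then obtain q where
    "(\<Sum>j\<in>{..k} - {0}. (p ^ l choose j) * (n choose (k - j))) = p * q" ..
  with * show ?thesis
    by (simp add: binomial_seq_def)
qed

lemma periodic_add_mult:
  assumes "\<And>n. s (n + T) = s n"
  shows "s (n + q * T) = s (n :: nat)"
proof (induction q)
  case (Suc q)
  then show ?case using assms [of "n + q * T"] by (simp add: algebra_simps)
qed simp

text \<open>Division with remainder: shifting by \<open>P mod T\<close> has the same effect as
  shifting by \<open>P\<close>, since the two differ by a multiple of \<open>T\<close>. A nonzero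
  remainder would thus be a period below the least one.\<close>

lemma has_period_dvd:
  assumes "has_period s T" and "\<And>n. s (n + P) = s n"
  shows "T dvd P"
proof (rule ccontr)
  assume "\<not> T dvd P"
  then have pos: "0 < P mod T"
    by (simp add: mod_greater_zero_iff_not_dvd)
  have T: "s (n + T) = s n" for n
    using assms(1) by (simp add: has_period_def)
  have "s (n + P mod T) = s n" for n
  proof -
    have "s (n + P mod T) = s ((n + P mod T) + (P div T) * T)"
      using T by (simp only: periodic_add_mult)
    also have "\<dots> = s (n + P)"
      by (simp add: add.assoc)
    finally show ?thesis using assms(2) by simp
  qed
  with pos assms(1) have "T \<le> P mod T"
    by (auto simp: has_period_def)
  moreover have "P mod T < T"
    using assms(1) by (simp add: has_period_def)
  ultimately show False by simp
qed

lemma has_period_exists: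
  assumes "0 < P" and "\<And>n. s (n + P) = s n"
  shows "\<exists>T. has_period s T"
proof -
  let ?Q = "\<lambda>T. 0 < T \<and> (\<forall>n. s (n + T) = s n)"
  have "?Q (LEAST T. ?Q T)"
    by (rule LeastI [of ?Q P]) (use assms in auto)
  then have "has_period s (LEAST T. ?Q T)"
    by (auto simp: has_period_def intro: Least_le)
  then show ?thesis ..
qed

lemma has_period_binomial_seq_prime_power:
  assumes "prime p" and "k < p ^ L"
  shows "\<exists>l\<le>L. has_period (binomial_seq p k) (p ^ l)"
proof -
  have per: "binomial_seq p k (n + p ^ L) = binomial_seq p k n" for n
    using assms by (rule binomial_seq_add_prime_power)
  have "0 < p ^ L"
    using assms(2) by (rule le_less_trans [OF le0])
  then obtain T where T: "has_period (binomial_seq p k) T"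
    using has_period_exists per by metis
  then have "T dvd p ^ L"
    using per by (rule has_period_dvd)
  then show ?thesis
    using T assms(1) by (auto simp: divides_primepow_nat)
qed

text \<open>The system for the coefficients is triangular with diagonal entries
  \<open>n choose n = 1\<close>, so it is solved successively over the integers without
  division.\<close>

lemma newton_interpolation:
  fixes f :: "nat \<Rightarrow> int"
  shows "\<exists>c. \<forall>n<N. f n = (\<Sum>k<N. c k * int (n choose k))"
proof (induction N)
  case (Suc N)
  then obtain c where c: "\<And>n. n < N \<Longrightarrow> f n = (\<Sum>k<N. c k * int (n choose k))"
    by blast
  \<comment> \<open>The new coefficient is the error at \<open>N\<close>. Its term leaves the values
    at \<open>n < N\<close> unchanged, because \<open>n choose N = 0\<close> there.\<close>
  define d where "d = c(N := f N - (\<Sum>k<N. c k * int (N choose k)))"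
  have "(\<Sum>k<N. d k * int (n choose k)) = (\<Sum>k<N. c k * int (n choose k))" for n
    by (rule sum.cong) (auto simp: d_def)
  then have "\<forall>n<Suc N. f n = (\<Sum>k<Suc N. d k * int (n choose k))"
    using c by (auto simp: less_Suc_eq d_def)
  then show ?case by blast
qed simp

theorem theorem18:
  fixes p L :: nat and s :: "nat \<Rightarrow> int"
  assumes "prime p"
    and "p_ary_seq p s"
    and "has_period s (p ^ L)"
  shows "\<exists>(K :: nat set) (c :: nat \<Rightarrow> int).
           finite K \<and>
           (\<forall>k\<in>K. c k \<in> carrier (residue_ring (int p))) \<and>
           (\<forall>k\<in>K. \<exists>l\<le>L. has_period (binomial_seq p k) (p ^ l)) \<and>
           (\<forall>n. s n = (\<Oplus>\<^bsub>residue_ring (int p)\<^esub>k\<in>K.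
                        c k \<otimes>\<^bsub>residue_ring (int p)\<^esub> binomial_seq p k n))"
proof -
  let ?R = "residue_ring (int p)"
  interpret residues "int p" ?R
    using prime_gt_1_nat [OF assms(1)] by unfold_locales simp_all
  obtain a where a: "\<And>n. n < p ^ L \<Longrightarrow> s n = (\<Sum>k<p ^ L. a k * int (n choose k))"
    using newton_interpolation [of "p ^ L" s] by blast
  define c where "c k = a k mod int p" for k
  \<comment> \<open>The candidate combination. Interpolation controls it only for
    \<open>n < p ^ L\<close>; the shared shift by \<open>p ^ L\<close> extends the agreement with
    \<open>s\<close> to all \<open>n\<close>.\<close>
  define t where "t n = (\<Oplus>\<^bsub>?R\<^esub>k\<in>{..<p ^ L}. c k \<otimes>\<^bsub>?R\<^esub> binomial_seq p k n)" for n
  have c_in: "c k \<in> carrier ?R" for k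
    by (simp add: c_def)
  have b_in: "binomial_seq p k n \<in> carrier ?R" for k n
    by (simp add: binomial_seq_def)
  have t_eq: "t n = (\<Sum>k<p ^ L. a k * int (n choose k)) mod int p" for n
  proof -
    have "t n = (\<Sum>k<p ^ L. c k * binomial_seq p k n mod int p) mod int p"
      unfolding t_def by (subst finsum_eq_sum_mod) (auto simp: res_mult_eq)
    also have "\<dots> = (\<Sum>k<p ^ L. a k * int (n choose k)) mod int p"
      by (simp add: c_def binomial_seq_def mod_mult_eq mod_sum_eq)
    finally show ?thesis .
  qed
  have t_period: "t (n + p ^ L) = t n" for n
    unfolding t_def using assms(1) c_in b_in
    by (intro finsum_cong') (auto simp: binomial_seq_add_prime_power)
  have s_period: "s (n + p ^ L) = s n" for n
    using assms(3) by (simp add: has_period_def)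
  have "0 < p ^ L"
    using assms(3) by (simp add: has_period_def)
  have "s n = t n" for n
  proof -
    define r where "r = n mod p ^ L"
    have n: "n = r + (n div p ^ L) * p ^ L"
      unfolding r_def by (rule mod_div_mult_eq [symmetric])
    have "s n = s r"
      by (subst n) (rule periodic_add_mult [where s = s, OF s_period])
    \<comment> \<open>The terms of \<open>s\<close> are reduced representatives, so agreement modulo
      \<open>p\<close> is equality.\<close>
    also have "\<dots> = s r mod int p"
      using assms(2) by (simp add: p_ary_seq_def res_carrier_eq)
    also have "\<dots> = t r"
      using a [of r] \<open>0 < p ^ L\<close> by (simp add: t_eq r_def)
    also have "\<dots> = t n"
      by (subst n) (rule periodic_add_mult [where s = t, OF t_period, symmetric])
    finally show ?thesis .
  qed
  then show ?thesis
    unfolding t_def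
    using c_in has_period_binomial_seq_prime_power [OF assms(1)]
    by (intro exI [of _ "{..<p ^ L}"] exI [of _ c]) auto
qed

end
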